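(* Let $G$ be a graph of order $n\ge 2$ with no isolated vertex. Then the following hold. 1. Bounds: $2\le \chi_i(G)\le n$. 2. Upper bound: $\chi_i(G)=n$ if and only if $G=K_n$. 3. Lower bound: every star $K_{1,n-1}$ satisfies $\chi_i=2$. If $G$ is not a star, then the following statements are equivalent: - (i) $\chi_i(G)=2$; - (ii) $G$ is a bipartite graph having Property $\Im_1$ or Property $\Im_2$ (for some bipartition); - (iii) $G\in\mathcal{F}_1\cup\mathcal{F}_2\cup\mathcal{F}_3$.
   Context: All graphs are finite, simple, undirected and connected. Neighborhoods and private neighbors. $N(v)$ denotes the open neighborhood and $N[v]=N(v)\cup\{v\}$ the closed neighborhood of $v$. For $S\subseteq V(G)$, $N[S]=\bigcup_{v\in S}N[v]$. For $v\in S$, $pn[v,S]=N[v]\setminus N[S\setminus\{v\}]$. Irredundance. A set $S$ is irredundant if $pn[v,S]\neq\emptyset$ for all $v\in S$. It is maximal irredundant if $S$ is irredundant and $S\cup\{w\}$ is not irredundant for every $w\notin S$. Irredundance coloring. An irredundance coloring is a proper coloring for which some maximal irredundant set $R$ has all its vertices colored pairwise differently. $\chi_i(G)$ is the minimum number of colors in an irredundance coloring. Bipartite graphs. Write $G(V_1,V_2)$ for a bipartite graph with bipartition $V_1,V_2$. Property $\Im_1$. $G(V_1,V_2)$ has Property $\Im_1$ if there exist adjacent vertices $v_1\in V_1$, $v_2\in V_2$ with $\deg(v_1)\ge 2$ and $\deg(v_2)\ge 2$ such that: - (a) every vertex of $V_2\setminus N(v_1)$ is adjacent to every vertex of $N(v_2)\setminus\{v_1\}$;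 - (b) every vertex of $V_1\setminus N(v_2)$ is adjacent to every vertex of $N(v_1)\setminus\{v_2\}$; - (c) for $\{i,j\}=\{1,2\}$, if $\deg(v_i)\ge 3$ then every $x\in N(v_i)$ satisfies at least one of: $x$ is a pendant vertex, $N(x)\subseteq N(v_j)$, or $N(x)=V_i$. Property $\Im_2$. $G(V_1,V_2)$ has Property $\Im_2$ if there exist non-adjacent $v_1\in V_1$, $v_2\in V_2$ with $N(v_1)=V_2\setminus\{v_2\}$ and $N(v_2)=V_1\setminus\{v_1\}$. Family $\mathcal{F}_1$. Let $K$ be the graph obtained from two stars, centered at $v_1$ and at $x$ and each having at least one leaf, together with a new vertex $v_2$ joined to both $v_1$ and $x$. $\mathcal{F}_1$ consists of the bipartite graphs obtained from some such $K$ by joining $x$ to some (possibly none, possibly all) of the vertices of $N_K(v_1)$. Family $\mathcal{F}_2$. $\mathcal{F}_2$ consists of the bipartite graphs $G(V_1,V_2)$ having $v_1\in V_1$, $v_2\in V_2$ with $N(v_1)=V_2$ and $N(v_2)=V_1$. Family $\mathcal{F}_3$. $\mathcal{F}_3$ consists of the bipartite graphs $G(V_1,V_2)$ having non-adjacent $v_1\in V_1$, $v_2\in V_2$ with $N(v_1)=V_2\setminus\{v_2\}$ and $N(v_2)=V_1\setminus\{v_1\}$. *)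

theory Defs
  imports "Graph_Theory.Graph_Theory"
begin

(* Finite simple undirected graphs are symmetric loop-free digraphs without parallel arcs
   (locale graph); u and v are adjacent iff (u, v) \<in> arcs_ends G. *)

definition nbh :: "('a, 'b) pre_digraph \<Rightarrow> 'a \<Rightarrow> 'a set" where
  "nbh G v = {u. v \<rightarrow>\<^bsub>G\<^esub> u}"

definition closed_nbh :: "('a, 'b) pre_digraph \<Rightarrow> 'a \<Rightarrow> 'a set" where
  "closed_nbh G v = insert v (nbh G v)"

definition closed_nbh_set :: "('a, 'b) pre_digraph \<Rightarrow> 'a set \<Rightarrow> 'a set" where
  "closed_nbh_set G S = (\<Union>v\<in>S. closed_nbh G v)"

definition deg :: "('a, 'b) pre_digraph \<Rightarrow> 'a \<Rightarrow> nat" where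
  "deg G v = card (nbh G v)"

definition private_nbh :: "('a, 'b) pre_digraph \<Rightarrow> 'a \<Rightarrow> 'a set \<Rightarrow> 'a set" where
  "private_nbh G v S = closed_nbh G v - closed_nbh_set G (S - {v})"

definition irredundant :: "('a, 'b) pre_digraph \<Rightarrow> 'a set \<Rightarrow> bool" where
  "irredundant G S \<longleftrightarrow> S \<subseteq> verts G \<and> (\<forall>v\<in>S. private_nbh G v S \<noteq> {})"

definition maximal_irredundant :: "('a, 'b) pre_digraph \<Rightarrow> 'a set \<Rightarrow> bool" where
  "maximal_irredundant G S \<longleftrightarrow>
     irredundant G S \<and> (\<forall>w\<in>verts G - S. \<not> irredundant G (S \<union> {w}))"

definition proper_coloring :: "('a, 'b) pre_digraph \<Rightarrow> ('a \<Rightarrow> nat) \<Rightarrow> bool" where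
  "proper_coloring G c \<longleftrightarrow> (\<forall>u v. u \<rightarrow>\<^bsub>G\<^esub> v \<longrightarrow> c u \<noteq> c v)"

definition irredundance_coloring :: "('a, 'b) pre_digraph \<Rightarrow> ('a \<Rightarrow> nat) \<Rightarrow> bool" where
  "irredundance_coloring G c \<longleftrightarrow>
     proper_coloring G c \<and> (\<exists>R. maximal_irredundant G R \<and> inj_on c R)"

definition irredundance_chromatic_number :: "('a, 'b) pre_digraph \<Rightarrow> nat" (\<open>\<chi>\<^sub>i\<close>) where
  "\<chi>\<^sub>i G = (LEAST k. \<exists>c. irredundance_coloring G c \<and> card (c ` verts G) = k)"

(* The minimum in the previous definition is over a nonempty set. *)
lemma (in graph) irredundance_coloring_exists: "\<exists>c. irredundance_coloring G c"
proof -
  have "finite {S. irredundant G S}"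
    by (rule finite_subset[of _ "Pow (verts G)"]) (auto simp: irredundant_def)
  moreover have "{} \<in> {S. irredundant G S}" by (simp add: irredundant_def)
  ultimately obtain R where R: "irredundant G R"
    and max: "\<And>S. irredundant G S \<Longrightarrow> R \<subseteq> S \<Longrightarrow> R = S"
    using finite_has_maximal[of "{S. irredundant G S}"] by blast
  have "maximal_irredundant G R"
    using R max by (auto simp: maximal_irredundant_def)
  moreover obtain c :: "'a \<Rightarrow> nat" where c: "inj_on c (verts G)"
    using finite_imp_inj_to_nat_seg[OF finite_verts] by blast
  moreover have "proper_coloring G c"
    unfolding proper_coloring_def
    by (metis adj_in_verts adj_not_same c inj_onD)
  moreover have "inj_on c R"
    using c R by (auto simp: irredundant_def intro: inj_on_subset)
  ultimately show ?thesis by (auto simp: irredundance_coloring_def)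
qed

definition bipartition :: "('a, 'b) pre_digraph \<Rightarrow> 'a set \<Rightarrow> 'a set \<Rightarrow> bool" where
  "bipartition G V1 V2 \<longleftrightarrow>
     verts G = V1 \<union> V2 \<and> V1 \<inter> V2 = {} \<and> arcs_ends G \<subseteq> V1 \<times> V2 \<union> V2 \<times> V1"

definition property_Im1 :: "('a, 'b) pre_digraph \<Rightarrow> 'a set \<Rightarrow> 'a set \<Rightarrow> bool" where
  "property_Im1 G V1 V2 \<longleftrightarrow>
     (\<exists>v1\<in>V1. \<exists>v2\<in>V2. v1 \<rightarrow>\<^bsub>G\<^esub> v2 \<and> 2 \<le> deg G v1 \<and> 2 \<le> deg G v2 \<and>
        (\<forall>y\<in>V2 - nbh G v1. \<forall>x\<in>nbh G v2 - {v1}. y \<rightarrow>\<^bsub>G\<^esub> x) \<and>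
        (\<forall>y\<in>V1 - nbh G v2. \<forall>x\<in>nbh G v1 - {v2}. y \<rightarrow>\<^bsub>G\<^esub> x) \<and>
        (3 \<le> deg G v1 \<longrightarrow>
           (\<forall>x\<in>nbh G v1. deg G x = 1 \<or> nbh G x \<subseteq> nbh G v2 \<or> nbh G x = V1)) \<and>
        (3 \<le> deg G v2 \<longrightarrow>
           (\<forall>x\<in>nbh G v2. deg G x = 1 \<or> nbh G x \<subseteq> nbh G v1 \<or> nbh G x = V2)))"

definition property_Im2 :: "('a, 'b) pre_digraph \<Rightarrow> 'a set \<Rightarrow> 'a set \<Rightarrow> bool" where
  "property_Im2 G V1 V2 \<longleftrightarrow>
     (\<exists>v1\<in>V1. \<exists>v2\<in>V2. \<not> v1 \<rightarrow>\<^bsub>G\<^esub> v2 \<and>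
        nbh G v1 = V2 - {v2} \<and> nbh G v2 = V1 - {v1})"

(* Adjacency relation of the graph K on {v1, v2, x} \<union> A \<union> B: a star with centre v1 and leaf set A,
   a star with centre x and leaf set B, and the vertex v2 joined to both centres. *)
definition linked_stars :: "'a \<Rightarrow> 'a set \<Rightarrow> 'a \<Rightarrow> 'a \<Rightarrow> 'a set \<Rightarrow> ('a \<times> 'a) set" where
  "linked_stars v1 A v2 x B = symcl ({v1} \<times> A \<union> {x} \<times> B \<union> {v2} \<times> {v1, x})"

(* linked_stars v1 A v2 x B `` {v1} is the neighbourhood of v1 in K. *)
definition family_F1 :: "('a, 'b) pre_digraph set" where
  "family_F1 = {G. graph G \<and> (\<exists>V1 V2. bipartition G V1 V2) \<and>
     (\<exists>v1 v2 x A B S. distinct [v1, v2, x] \<and> A \<noteq> {} \<and> B \<noteq> {} \<and>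
        A \<inter> B = {} \<and> (A \<union> B) \<inter> {v1, v2, x} = {} \<and>
        S \<subseteq> linked_stars v1 A v2 x B `` {v1} \<and>
        verts G = {v1, v2, x} \<union> A \<union> B \<and>
        arcs_ends G = linked_stars v1 A v2 x B \<union> symcl ({x} \<times> S))}"

definition family_F2 :: "('a, 'b) pre_digraph set" where
  "family_F2 = {G. graph G \<and> (\<exists>V1 V2. bipartition G V1 V2 \<and>
     (\<exists>v1\<in>V1. \<exists>v2\<in>V2. nbh G v1 = V2 \<and> nbh G v2 = V1))}"

definition family_F3 :: "('a, 'b) pre_digraph set" where
  "family_F3 = {G. graph G \<and> (\<exists>V1 V2. bipartition G V1 V2 \<and>
     (\<exists>v1\<in>V1. \<exists>v2\<in>V2. \<not> v1 \<rightarrow>\<^bsub>G\<^esub> v2 \<and>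
        nbh G v1 = V2 - {v2} \<and> nbh G v2 = V1 - {v1}))}"

end

theory Submission
  imports Defs
begin

text \<open>
  If \<open>R\<close> is maximal irredundant and \<open>w \<notin> R\<close>, then \<open>w\<close> may share its colour with any non-neighbour;
  so \<open>\<chi>\<^sub>i = n\<close> forces \<open>w\<close> to be dominating, hence \<open>{w}\<close> to be maximal irredundant, hence every other
  pair of vertices to be adjacent. A colouring with two colours is a bipartition together with a
  maximal irredundant set meeting each side at most once. Such a set is a single dominating vertex
  (the graph is then a star) or a pair \<open>{v1, v2}\<close>; computing the private neighbours in
  \<open>{v1, v2, w}\<close> for each further vertex \<open>w\<close> turns maximality into \<open>property_Im2\<close> if the pair is
  non-adjacent and into \<open>property_Im1\<close> if it is adjacent. The families arise from \<open>property_Im1\<close> by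
  distinguishing which of \<open>nbh v1 = V2\<close> and \<open>nbh v2 = V1\<close> hold: both give \<open>family_F2\<close>, one gives
  \<open>family_F1\<close> or \<open>family_F2\<close>, none gives \<open>family_F2\<close> or \<open>family_F3\<close>.
\<close>

section \<open>Adjacency, degrees and elementary bounds\<close>

lemma mem_nbh [simp]: "u \<in> nbh G v \<longleftrightarrow> v \<rightarrow>\<^bsub>G\<^esub> u"
  by (simp add: nbh_def)

lemma mem_symcl_iff: "(u, v) \<in> symcl R \<longleftrightarrow> (u, v) \<in> R \<or> (v, u) \<in> R"
  by (force simp: symcl_def)

lemma bipartition_swap: "bipartition G V1 V2 \<Longrightarrow> bipartition G V2 V1"
  by (auto simp: bipartition_def)

lemma irredundance_chromatic_number_le:
  assumes "irredundance_coloring G c"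
  shows "\<chi>\<^sub>i G \<le> card (c ` verts G)"
  unfolding irredundance_chromatic_number_def using assms by (auto intro: Least_le)

context graph
begin

lemma adj_commute: "u \<rightarrow>\<^bsub>G\<^esub> v \<longleftrightarrow> v \<rightarrow>\<^bsub>G\<^esub> u"
  using sym_arcs by (auto simp: symmetric_def sym_def)

lemma finite_nbh [simp]: "finite (nbh G v)"
  by (rule finite_subset[OF _ finite_verts]) (auto dest: adj_in_verts)

text \<open>Degrees are expressed through \<open>nbh G v - {u}\<close> because, for an adjacent pair
  \<open>{v, u}\<close> in a bipartite graph, this is the private neighbourhood of
  \<open>v\<close>.\<close>

lemma deg_ge_2_iff:
  assumes "v \<rightarrow>\<^bsub>G\<^esub> u"
  shows "2 \<le> deg G v \<longleftrightarrow> nbh G v - {u} \<noteq> {}"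
proof -
  have "deg G v = Suc (card (nbh G v - {u}))"
    using assms card_Suc_Diff1[of "nbh G v" u] by (simp add: deg_def)
  then show ?thesis by (auto simp: Suc_le_eq card_gt_0_iff)
qed

text \<open>Here \<open>x\<close> stands for a vertex added to the pair \<open>{v, u}\<close>:
  \<open>v\<close> keeps a private neighbour among its own neighbours exactly when some neighbour
  besides \<open>u\<close> and \<open>x\<close> is left.\<close>

lemma deg_ge_3_iff:
  assumes "v \<rightarrow>\<^bsub>G\<^esub> u" "x \<in> nbh G v - {u}"
  shows "3 \<le> deg G v \<longleftrightarrow> nbh G v - {u} \<noteq> {x}"
proof -
  have "deg G v = Suc (Suc (card (nbh G v - {u} - {x})))"
    using assms card_Suc_Diff1[of "nbh G v" u] card_Suc_Diff1[of "nbh G v - {u}" x]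
    by (simp add: deg_def)
  then have "3 \<le> deg G v \<longleftrightarrow> nbh G v - {u} - {x} \<noteq> {}"
    by (auto simp: Suc_le_eq card_gt_0_iff numeral_3_eq_3)
  then show ?thesis using assms(2) by blast
qed

lemma irredundance_chromatic_number_attained:
  obtains c where "irredundance_coloring G c" "card (c ` verts G) = \<chi>\<^sub>i G"
proof -
  have "\<exists>k c. irredundance_coloring G c \<and> card (c ` verts G) = k"
    using irredundance_coloring_exists by blast
  from LeastI_ex[OF this] show ?thesis
    using that unfolding irredundance_chromatic_number_def by blast
qed

lemma maximal_irredundant_exists:
  obtains R where "maximal_irredundant G R"
  using irredundance_coloring_exists by (auto simp: irredundance_coloring_def)

lemma irredundance_chromatic_number_le_order: "\<chi>\<^sub>i G \<le> card (verts G)"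
proof -
  obtain c where "irredundance_coloring G c" "card (c ` verts G) = \<chi>\<^sub>i G"
    by (rule irredundance_chromatic_number_attained)
  then show ?thesis
    using card_image_le[OF finite_verts, of c] by simp
qed

lemma irredundance_chromatic_number_ge_2:
  assumes "u \<rightarrow>\<^bsub>G\<^esub> v"
  shows "2 \<le> \<chi>\<^sub>i G"
proof -
  obtain c where c: "irredundance_coloring G c" "card (c ` verts G) = \<chi>\<^sub>i G"
    by (rule irredundance_chromatic_number_attained)
  have "c u \<noteq> c v"
    using c(1) assms by (auto simp: irredundance_coloring_def proper_coloring_def)
  then have "card {c u, c v} = 2" by simp
  moreover have "{c u, c v} \<subseteq> c ` verts G"
    using assms by (auto dest: adj_in_verts)
  ultimately show ?thesis
    using c(2) card_mono[of "c ` verts G" "{c u, c v}"] by simp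
qed

section \<open>Irredundant sets in general graphs\<close>

lemma irredundant_singleton: "v \<in> verts G \<Longrightarrow> irredundant G {v}"
  by (auto simp: irredundant_def private_nbh_def closed_nbh_def closed_nbh_set_def)

lemma maximal_irredundant_nonempty:
  assumes "maximal_irredundant G R" "verts G \<noteq> {}"
  shows "R \<noteq> {}"
  using assms irredundant_singleton by (auto simp: maximal_irredundant_def)

text \<open>Distinct non-adjacent vertices are their own private neighbours, so any non-neighbour
  could join \<open>v\<close>. Conversely, a dominating \<open>v\<close> leaves nothing private to a
  second vertex.\<close>

lemma maximal_irredundant_singleton_iff:
  "maximal_irredundant G {v} \<longleftrightarrow> v \<in> verts G \<and> nbh G v = verts G - {v}"
proof
  assume max: "maximal_irredundant G {v}"
  then have v: "v \<in> verts G" by (auto simp: maximal_irredundant_def irredundant_def)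
  have "v \<rightarrow>\<^bsub>G\<^esub> w" if w: "w \<in> verts G" "w \<noteq> v" for w
  proof (rule ccontr)
    assume "\<not> v \<rightarrow>\<^bsub>G\<^esub> w"
    with v w have "irredundant G {v, w}"
      by (auto simp: irredundant_def private_nbh_def closed_nbh_def closed_nbh_set_def
          insert_Diff_if adj_commute)
    moreover have "\<not> irredundant G {v, w}"
      using max w by (auto simp: maximal_irredundant_def insert_commute)
    ultimately show False by blast
  qed
  then have "verts G - {v} \<subseteq> nbh G v" by fastforce
  moreover have "nbh G v \<subseteq> verts G - {v}" by (auto dest: adj_in_verts adj_not_same)
  ultimately have "nbh G v = verts G - {v}" by blast
  with v show "v \<in> verts G \<and> nbh G v = verts G - {v}" by blast
next
  assume *: "v \<in> verts G \<and> nbh G v = verts G - {v}"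
  have "\<not> irredundant G {v, w}" if w: "w \<in> verts G" "w \<noteq> v" for w
  proof -
    have "closed_nbh G v = verts G"
      unfolding closed_nbh_def using * by blast
    moreover have "closed_nbh G w \<subseteq> verts G"
      using w by (auto simp: closed_nbh_def dest: adj_in_verts)
    ultimately have "closed_nbh G w \<subseteq> closed_nbh G v" by blast
    then have "private_nbh G w {v, w} = {}"
      using w by (auto simp: private_nbh_def closed_nbh_set_def)
    then show ?thesis by (auto simp: irredundant_def)
  qed
  with * show "maximal_irredundant G {v}"
    by (auto simp: maximal_irredundant_def irredundant_singleton insert_commute)
qed

text \<open>If every vertex were in \<open>R\<close>, a private neighbour \<open>u\<close> of
  \<open>v\<close> would be dominated by itself and by each of its neighbours, so both
  \<open>u\<close> and a neighbour of \<open>u\<close> would equal \<open>v\<close>, giving a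
  loop.\<close>

lemma irredundant_neq_verts:
  assumes "irredundant G R" "verts G \<noteq> {}" "\<forall>v\<in>verts G. nbh G v \<noteq> {}"
  shows "R \<noteq> verts G"
proof
  assume R: "R = verts G"
  obtain v where v: "v \<in> verts G" using assms(2) by blast
  obtain u where u: "u \<in> private_nbh G v R"
    using assms(1) R v by (auto simp: irredundant_def)
  then have "u \<in> verts G"
    using v by (auto simp: private_nbh_def closed_nbh_def dest: adj_in_verts)
  moreover obtain w where w: "u \<rightarrow>\<^bsub>G\<^esub> w"
    using assms(3) \<open>u \<in> verts G\<close> by fastforce
  moreover have "u = v"
    using u R \<open>u \<in> verts G\<close> by (auto simp: private_nbh_def closed_nbh_def closed_nbh_set_def)
  moreover have "w = v"
    using u R w by (auto simp: private_nbh_def closed_nbh_def closed_nbh_set_def adj_commute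
        dest: adj_in_verts)
  ultimately show False by (auto dest: adj_not_same)
qed

section \<open>The upper bound and complete graphs\<close>

text \<open>Take an injective colouring and give \<open>u\<close> the colour of \<open>v\<close>.
  Non-adjacency keeps the colouring proper, and \<open>u \<notin> R\<close> keeps the colours on
  \<open>R\<close> distinct.\<close>

lemma irredundance_chromatic_number_less:
  assumes max: "maximal_irredundant G R"
    and uv: "u \<in> verts G" "v \<in> verts G" "u \<noteq> v" "\<not> u \<rightarrow>\<^bsub>G\<^esub> v" "u \<notin> R"
  shows "\<chi>\<^sub>i G < card (verts G)"
proof -
  obtain f :: "'a \<Rightarrow> nat" where f: "inj_on f (verts G)"
    using finite_imp_inj_to_nat_seg[OF finite_verts] by blast
  define c where "c = f(u := f v)"
  have R: "R \<subseteq> verts G"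
    using max by (auto simp: maximal_irredundant_def irredundant_def)
  have merge: "c x = c y \<Longrightarrow> x = y \<or> {x, y} = {u, v}" if "x \<in> verts G" "y \<in> verts G" for x y
    using that f uv by (auto simp: c_def inj_on_eq_iff split: if_splits)
  have "proper_coloring G c"
    unfolding proper_coloring_def
  proof (intro allI impI notI)
    fix x y assume xy: "x \<rightarrow>\<^bsub>G\<^esub> y" "c x = c y"
    then have "x = y \<or> {x, y} = {u, v}" using merge by (auto dest: adj_in_verts)
    with xy(1) uv(4) show False
      by (auto simp: doubleton_eq_iff adj_commute dest: adj_not_same)
  qed
  moreover have "inj_on c R"
    using merge R uv(5) by (auto simp: inj_on_def doubleton_eq_iff)
  ultimately have "\<chi>\<^sub>i G \<le> card (c ` verts G)"
    using max by (intro irredundance_chromatic_number_le) (auto simp: irredundance_coloring_def)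
  also have "c ` verts G \<subseteq> f ` (verts G - {u})"
    using uv by (auto simp: c_def)
  then have "card (c ` verts G) \<le> card (f ` (verts G - {u}))"
    by (intro card_mono) auto
  also have "\<dots> \<le> card (verts G - {u})" by (rule card_image_le) auto
  also have "\<dots> < card (verts G)" using uv by (intro psubset_card_mono) auto
  finally show ?thesis .
qed

lemma irredundance_chromatic_number_eq_order_iff:
  assumes "verts G \<noteq> {}" "\<forall>v\<in>verts G. nbh G v \<noteq> {}"
  shows "\<chi>\<^sub>i G = card (verts G) \<longleftrightarrow> complete_digraph (card (verts G)) G"
proof
  assume eq: "\<chi>\<^sub>i G = card (verts G)"
  obtain R where R: "maximal_irredundant G R" by (rule maximal_irredundant_exists)
  then have "R \<noteq> verts G" "R \<subseteq> verts G"
    using irredundant_neq_verts[OF _ assms] by (auto simp: maximal_irredundant_def irredundant_def)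
  then obtain w where w: "w \<in> verts G" "w \<notin> R" by blast
  then have adj_w: "w \<rightarrow>\<^bsub>G\<^esub> v" if "v \<in> verts G" "v \<noteq> w" for v
    using irredundance_chromatic_number_less[OF R w(1) that(1)] that eq by auto
  then have "verts G - {w} \<subseteq> nbh G w" by fastforce
  moreover have "nbh G w \<subseteq> verts G - {w}" by (auto dest: adj_in_verts adj_not_same)
  ultimately have "nbh G w = verts G - {w}" by blast
  then have max_w: "maximal_irredundant G {w}"
    using w by (simp add: maximal_irredundant_singleton_iff)
  \<comment> \<open>The recolouring is applied again, now with \<open>{w}\<close> as the maximal
    irredundant set, so that every \<open>u\<close> other than \<open>w\<close> may be recoloured.
    The case \<open>u = w\<close> is \<open>adj_w\<close>.\<close>
  have "u \<rightarrow>\<^bsub>G\<^esub> v" if "u \<in> verts G" "v \<in> verts G" "u \<noteq> v" for u v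
    using that irredundance_chromatic_number_less[OF max_w that] eq adj_w by auto
  then have "arcs_ends G = {(u, v). (u, v) \<in> verts G \<times> verts G \<and> u \<noteq> v}"
    by (auto dest: adj_in_verts adj_not_same)
  then show "complete_digraph (card (verts G)) G"
    using graph_axioms by (auto simp: complete_digraph_def)
next
  assume compl: "complete_digraph (card (verts G)) G"
  obtain c where c: "irredundance_coloring G c" "card (c ` verts G) = \<chi>\<^sub>i G"
    by (rule irredundance_chromatic_number_attained)
  have "inj_on c (verts G)"
    using c(1) compl
    by (auto simp: inj_on_def irredundance_coloring_def proper_coloring_def complete_digraph_def)
  then show "\<chi>\<^sub>i G = card (verts G)"
    using c(2) by (simp add: card_image)
qed

section \<open>Two colours, bipartitions and stars\<close>

text \<open>The sides of the bipartition are the colour classes, and distinct colours on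
  \<open>R\<close> mean at most one vertex of \<open>R\<close> in each class.\<close>

lemma irredundance_chromatic_number_eq_2_iff:
  assumes edge: "u \<rightarrow>\<^bsub>G\<^esub> v"
  shows "\<chi>\<^sub>i G = 2 \<longleftrightarrow> (\<exists>V1 V2 R. bipartition G V1 V2 \<and> maximal_irredundant G R \<and>
    card (R \<inter> V1) \<le> 1 \<and> card (R \<inter> V2) \<le> 1)" (is "_ \<longleftrightarrow> ?R")
proof
  assume eq: "\<chi>\<^sub>i G = 2"
  obtain c where c: "irredundance_coloring G c" "card (c ` verts G) = \<chi>\<^sub>i G"
    by (rule irredundance_chromatic_number_attained)
  then obtain R where R: "maximal_irredundant G R" "inj_on c R"
    and proper: "proper_coloring G c" by (auto simp: irredundance_coloring_def)
  obtain a b where ab: "c ` verts G = {a, b}" "a \<noteq> b"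
    using c(2) eq by (auto simp: card_2_iff)
  define V where "V i = {x \<in> verts G. c x = i}" for i
  have "verts G = V a \<union> V b" "V a \<inter> V b = {}"
    using ab by (auto simp: V_def)
  moreover have "x \<in> V a \<and> y \<in> V b \<or> x \<in> V b \<and> y \<in> V a" if "x \<rightarrow>\<^bsub>G\<^esub> y" for x y
  proof -
    have "x \<in> V a \<union> V b" "y \<in> V a \<union> V b" "c x \<noteq> c y"
      using that proper \<open>verts G = V a \<union> V b\<close> adj_in_verts[OF that]
      by (auto simp: proper_coloring_def)
    then show ?thesis by (auto simp: V_def)
  qed
  ultimately have "bipartition G (V a) (V b)"
    unfolding bipartition_def by auto
  moreover have "card (R \<inter> V i) \<le> 1" for i
  proof -
    have "x = y" if "x \<in> R \<inter> V i" "y \<in> R \<inter> V i" for x y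
      using that R(2) by (auto simp: V_def dest: inj_onD)
    moreover have "finite (R \<inter> V i)" by (auto simp: V_def)
    ultimately show ?thesis using card_le_Suc0_iff_eq[of "R \<inter> V i"] by simp
  qed
  ultimately show ?R using R(1) by blast
next
  assume ?R
  then obtain V1 V2 R where B: "bipartition G V1 V2" and R: "maximal_irredundant G R"
    "card (R \<inter> V1) \<le> 1" "card (R \<inter> V2) \<le> 1" by blast
  have fin: "finite V1" "finite V2"
    using B finite_verts by (auto simp: bipartition_def intro: finite_subset)
  define c where "c x = (if x \<in> V1 then 0 else 1 :: nat)" for x
  have "proper_coloring G c"
    using B by (auto simp: proper_coloring_def c_def bipartition_def)
  moreover have "inj_on c R"
  proof (rule inj_onI)
    fix x y assume xy: "x \<in> R" "y \<in> R" "c x = c y"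
    then have "x \<in> V1 \<union> V2" "y \<in> V1 \<union> V2"
      using R(1) B by (auto simp: maximal_irredundant_def irredundant_def bipartition_def)
    then have "{x, y} \<subseteq> R \<inter> V1 \<or> {x, y} \<subseteq> R \<inter> V2"
      using xy by (auto simp: c_def split: if_splits)
    then show "x = y"
      using R fin card_le_Suc0_iff_eq[of "R \<inter> V1"] card_le_Suc0_iff_eq[of "R \<inter> V2"] by auto
  qed
  ultimately have "\<chi>\<^sub>i G \<le> card (c ` verts G)"
    using R(1) by (intro irredundance_chromatic_number_le) (auto simp: irredundance_coloring_def)
  also have "\<dots> \<le> card {0, 1 :: nat}" by (rule card_mono) (auto simp: c_def)
  finally show "\<chi>\<^sub>i G = 2" using irredundance_chromatic_number_ge_2[OF edge] by simp
qed

text \<open>Identifies the one-vertex side of the star with a dominating vertex, which is what a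
  maximal irredundant singleton provides. The bipartition rules out edges between leaves.\<close>

lemma star_iff:
  assumes "card (verts G) = n" "n \<ge> 1"
  shows "complete_bipartite_digraph 1 (n - 1) G \<longleftrightarrow>
    (\<exists>v\<in>verts G. bipartition G {v} (verts G - {v}) \<and> nbh G v = verts G - {v})" (is "?L \<longleftrightarrow> ?R")
proof
  assume ?L
  then obtain U V where UV: "verts G = U \<union> V" "U \<inter> V = {}" "card U = 1"
    "arcs_ends G = U \<times> V \<union> V \<times> U" by (auto simp: complete_bipartite_digraph_def)
  then obtain v where "U = {v}" by (auto simp: card_1_singleton_iff)
  then show ?R using UV by (intro bexI[of _ v]) (auto simp: bipartition_def nbh_def)
next
  assume ?R
  then obtain v where v: "v \<in> verts G" "bipartition G {v} (verts G - {v})"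
    "nbh G v = verts G - {v}" by blast
  have "v \<rightarrow>\<^bsub>G\<^esub> u \<longleftrightarrow> u \<in> verts G - {v}" for u using v(3) by (metis mem_nbh)
  then have "arcs_ends G = {v} \<times> (verts G - {v}) \<union> (verts G - {v}) \<times> {v}"
    using v(2) adj_commute[of _ v] by (auto simp: bipartition_def)
  then show ?L
    unfolding complete_bipartite_digraph_def using v(1) assms graph_axioms
    by (intro conjI exI[of _ "{v}"] exI[of _ "verts G - {v}"])
      (simp_all add: insert_absorb)
qed

end

section \<open>Irredundant pairs and triples in bipartite graphs\<close>

locale bipartite_graph = graph G for G :: "('a, 'b) pre_digraph" +
  fixes V1 V2 :: "'a set"
  assumes bip: "bipartition G V1 V2"
begin

text \<open>Interpreting the locale again with the sides exchanged transfers each one-sided result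
  to the other side.\<close>

lemma swap: "bipartite_graph G V2 V1"
  by unfold_locales (rule bipartition_swap[OF bip])

lemma verts_eq: "verts G = V1 \<union> V2" and disjoint: "V1 \<inter> V2 = {}"
  using bip by (auto simp: bipartition_def)

lemma adj_cross: "u \<rightarrow>\<^bsub>G\<^esub> v \<Longrightarrow> (u \<in> V1 \<longleftrightarrow> v \<in> V2) \<and> (u \<in> V2 \<longleftrightarrow> v \<in> V1)"
  using bip by (auto simp: bipartition_def)

lemma nbh_subset: "v \<in> V1 \<Longrightarrow> nbh G v \<subseteq> V2" "v \<in> V2 \<Longrightarrow> nbh G v \<subseteq> V1"
  using adj_cross by auto

text \<open>Both vertices are self-private. A vertex dominated by neither would be self-private too
  and could be added, so maximality means that the pair dominates the graph; each vertex must then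
  be dominated from the opposite side.\<close>

lemma maximal_irredundant_nonadjacent_pair_iff:
  assumes v: "v1 \<in> V1" "v2 \<in> V2" "\<not> v1 \<rightarrow>\<^bsub>G\<^esub> v2"
  shows "maximal_irredundant G {v1, v2} \<longleftrightarrow> nbh G v1 = V2 - {v2} \<and> nbh G v2 = V1 - {v1}"
proof
  assume max: "maximal_irredundant G {v1, v2}"
  have dom: "v1 \<rightarrow>\<^bsub>G\<^esub> w \<or> v2 \<rightarrow>\<^bsub>G\<^esub> w" if w: "w \<in> verts G" "w \<noteq> v1" "w \<noteq> v2" for w
  proof (rule ccontr)
    assume "\<not> ?thesis"
    then have "irredundant G {v1, v2, w}"
      using v w disjoint verts_eq
      by (auto simp: irredundant_def private_nbh_def closed_nbh_def closed_nbh_set_def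
          insert_Diff_if adj_commute)
    then show False
      using max w by (auto simp: maximal_irredundant_def insert_commute)
  qed
  have "v1 \<rightarrow>\<^bsub>G\<^esub> w" if "w \<in> V2" "w \<noteq> v2" for w
    using that dom[of w] adj_cross[of v2 w] v disjoint verts_eq by auto
  then have "V2 - {v2} \<subseteq> nbh G v1" by fastforce
  moreover have "v2 \<rightarrow>\<^bsub>G\<^esub> w" if "w \<in> V1" "w \<noteq> v1" for w
    using that dom[of w] adj_cross[of v1 w] v disjoint verts_eq by auto
  then have "V1 - {v1} \<subseteq> nbh G v2" by fastforce
  moreover have "nbh G v1 \<subseteq> V2 - {v2}" "nbh G v2 \<subseteq> V1 - {v1}"
    using v nbh_subset[of v1] nbh_subset[of v2] adj_commute[of v1 v2] by auto
  ultimately show "nbh G v1 = V2 - {v2} \<and> nbh G v2 = V1 - {v1}" by blast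
next
  assume *: "nbh G v1 = V2 - {v2} \<and> nbh G v2 = V1 - {v1}"
  then have "closed_nbh_set G {v1, v2} = verts G"
    using v verts_eq by (auto simp: closed_nbh_set_def closed_nbh_def)
  moreover have "closed_nbh G w \<subseteq> verts G" if "w \<in> verts G" for w
    using that by (auto simp: closed_nbh_def dest: adj_in_verts)
  ultimately have "private_nbh G w ({v1, v2} \<union> {w}) = {}" if "w \<in> verts G - {v1, v2}" for w
    using that by (fastforce simp: private_nbh_def closed_nbh_set_def)
  moreover have "v1 \<in> private_nbh G v1 {v1, v2}" "v2 \<in> private_nbh G v2 {v1, v2}"
    using v disjoint
    by (auto simp: private_nbh_def closed_nbh_def closed_nbh_set_def insert_Diff_if adj_commute)
  ultimately show "maximal_irredundant G {v1, v2}"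
    using v verts_eq by (fastforce simp: maximal_irredundant_def irredundant_def)
qed

text \<open>The two vertices dominate each other, so neither is self-private. There are no
  triangles, so all their remaining neighbours are private.\<close>

lemma irredundant_adjacent_pair_iff:
  assumes v: "v1 \<in> V1" "v2 \<in> V2" "v1 \<rightarrow>\<^bsub>G\<^esub> v2"
  shows "irredundant G {v1, v2} \<longleftrightarrow> nbh G v1 - {v2} \<noteq> {} \<and> nbh G v2 - {v1} \<noteq> {}"
proof -
  have "v1 \<in> nbh G v2" "v2 \<in> nbh G v1" using v adj_commute by auto
  then have "private_nbh G v1 {v1, v2} = nbh G v1 - {v2}"
    "private_nbh G v2 {v1, v2} = nbh G v2 - {v1}"
    using v nbh_subset(1)[OF v(1)] nbh_subset(2)[OF v(2)] disjoint
    by (auto simp: private_nbh_def closed_nbh_def closed_nbh_set_def insert_Diff_if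
        simp del: mem_nbh)
  then show ?thesis using v verts_eq by (auto simp: irredundant_def)
qed

text \<open>The vertex \<open>y\<close> is adjacent to neither \<open>v1\<close> nor
  \<open>v2\<close>, hence self-private. It lies on the side of \<open>v2\<close>, so it can take
  private neighbours only from \<open>v2\<close>.\<close>

lemma irredundant_adjacent_pair_insert_nonneighbor_iff:
  assumes v: "v1 \<in> V1" "v2 \<in> V2" "v1 \<rightarrow>\<^bsub>G\<^esub> v2" and y: "y \<in> V2 - nbh G v1"
  shows "irredundant G {v1, v2, y} \<longleftrightarrow> nbh G v1 - {v2} \<noteq> {} \<and> \<not> nbh G v2 - {v1} \<subseteq> nbh G y"
proof -
  have ne: "v1 \<noteq> v2" "y \<noteq> v1" "y \<noteq> v2" using v y disjoint by auto
  have "v1 \<in> nbh G v2" "v2 \<in> nbh G v1" using v adj_commute by auto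
  moreover have "v1 \<notin> nbh G y" using y adj_commute by auto
  ultimately have "private_nbh G v1 {v1, v2, y} = nbh G v1 - {v2}"
    "private_nbh G v2 {v1, v2, y} = nbh G v2 - {v1} - nbh G y"
    "y \<in> private_nbh G y {v1, v2, y}"
    using y ne v nbh_subset(1)[OF v(1)] nbh_subset(2)[OF v(2)] nbh_subset(2)[of y] disjoint
    by (auto simp: private_nbh_def closed_nbh_def closed_nbh_set_def insert_Diff_if
        simp del: mem_nbh)
  then show ?thesis using v y verts_eq by (auto simp: irredundant_def)
qed

text \<open>The three conjuncts say, in order, that \<open>v1\<close>, \<open>v2\<close> and
  \<open>x\<close> have a private neighbour. As a neighbour of \<open>v1\<close>, \<open>x\<close>
  is not self-private and itself drops out of the private neighbours of \<open>v1\<close>.\<close>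

lemma irredundant_adjacent_pair_insert_neighbor_iff:
  assumes v: "v1 \<in> V1" "v2 \<in> V2" "v1 \<rightarrow>\<^bsub>G\<^esub> v2" and x: "x \<in> nbh G v1 - {v2}"
  shows "irredundant G {v1, v2, x} \<longleftrightarrow>
    nbh G v1 - {v2} \<noteq> {x} \<and> \<not> nbh G v2 - {v1} \<subseteq> nbh G x \<and> \<not> nbh G x \<subseteq> nbh G v2"
proof -
  have xV: "x \<in> V2" using v x nbh_subset by blast
  have ne: "v1 \<noteq> v2" "x \<noteq> v1" "x \<noteq> v2" using v x xV disjoint by auto
  have "v1 \<in> nbh G v2" "v2 \<in> nbh G v1" "v1 \<in> nbh G x" using v x adj_commute by auto
  then have "private_nbh G v1 {v1, v2, x} = nbh G v1 - {v2} - {x}"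
    "private_nbh G v2 {v1, v2, x} = nbh G v2 - {v1} - nbh G x"
    "private_nbh G x {v1, v2, x} = nbh G x - nbh G v2"
    using x ne v xV nbh_subset(1)[OF v(1)] nbh_subset(2)[OF v(2)] nbh_subset(2)[OF xV] disjoint
    by (auto simp: private_nbh_def closed_nbh_def closed_nbh_set_def insert_Diff_if
        simp del: mem_nbh)
  moreover have "{v1, v2, x} \<subseteq> verts G" using v xV verts_eq by blast
  ultimately show ?thesis using x unfolding irredundant_def by (simp del: mem_nbh) blast
qed

end

section \<open>Property Im1 as maximality of an adjacent pair\<close>

text \<open>The part of \<open>property_Im1\<close> saying that no non-neighbour of \<open>v2\<close> in \<open>V1\<close> and no neighbour of
  \<open>v1\<close> can be added to \<open>{v1, v2}\<close>: in (c), \<open>deg v1 = 2\<close>, \<open>nbh x = V1\<close> and \<open>nbh x \<subseteq> nbh v2\<close> mean that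
  \<open>v1\<close>, \<open>v2\<close> and \<open>x\<close>, respectively, would lose its private neighbours. The pendant case is
  contained in the last one.\<close>

definition Im1_half :: "('a, 'b) pre_digraph \<Rightarrow> 'a set \<Rightarrow> 'a \<Rightarrow> 'a \<Rightarrow> bool" where
  "Im1_half G V1 v1 v2 \<longleftrightarrow>
     (\<forall>y\<in>V1 - nbh G v2. \<forall>x\<in>nbh G v1 - {v2}. y \<rightarrow>\<^bsub>G\<^esub> x) \<and>
     (3 \<le> deg G v1 \<longrightarrow>
        (\<forall>x\<in>nbh G v1. deg G x = 1 \<or> nbh G x \<subseteq> nbh G v2 \<or> nbh G x = V1))"

text \<open>Groups (b) with (c) for \<open>v1\<close>, and (a) with (c) for \<open>v2\<close>;
  exchanging the sides exchanges the two groups.\<close>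

lemma property_Im1_iff:
  "property_Im1 G V1 V2 \<longleftrightarrow> (\<exists>v1\<in>V1. \<exists>v2\<in>V2. v1 \<rightarrow>\<^bsub>G\<^esub> v2 \<and> 2 \<le> deg G v1 \<and> 2 \<le> deg G v2 \<and>
     Im1_half G V1 v1 v2 \<and> Im1_half G V2 v2 v1)"
  unfolding property_Im1_def Im1_half_def by (intro bex_cong refl) argo

context bipartite_graph
begin

text \<open>Brings the half into the form delivered by the insertion lemmas. Given
  \<open>?a\<close>, a vertex \<open>x\<close> adjacent to all of \<open>nbh G v2 - {v1}\<close> is
  adjacent to all of \<open>V1\<close>: \<open>?a\<close> covers the vertices outside
  \<open>nbh G v2\<close>, and \<open>v1\<close> is a neighbour of \<open>x\<close> anyway.\<close>

lemma Im1_half_iff: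
  assumes v: "v1 \<in> V1" "v2 \<in> V2" "v1 \<rightarrow>\<^bsub>G\<^esub> v2"
  shows "Im1_half G V1 v1 v2 \<longleftrightarrow>
    (\<forall>y\<in>V1 - nbh G v2. nbh G v1 - {v2} \<subseteq> nbh G y) \<and>
    (\<forall>x\<in>nbh G v1 - {v2}. nbh G v1 - {v2} = {x} \<or> nbh G v2 - {v1} \<subseteq> nbh G x \<or> nbh G x \<subseteq> nbh G v2)"
    (is "_ \<longleftrightarrow> ?a \<and> ?c")
proof -
  have "(3 \<le> deg G v1 \<longrightarrow>
        (\<forall>x\<in>nbh G v1. deg G x = 1 \<or> nbh G x \<subseteq> nbh G v2 \<or> nbh G x = V1)) \<longleftrightarrow> ?c"
    (is "?d \<longleftrightarrow> _") if a: ?a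
  proof -
    have *: "(deg G x = 1 \<or> nbh G x \<subseteq> nbh G v2 \<or> nbh G x = V1) \<longleftrightarrow>
      (nbh G v2 - {v1} \<subseteq> nbh G x \<or> nbh G x \<subseteq> nbh G v2)" (is "?p \<longleftrightarrow> ?q")
      if x: "x \<in> nbh G v1 - {v2}" for x
    proof
      have v1x: "v1 \<in> nbh G x" using x adj_commute by auto
      have xV: "x \<in> V2" using v x nbh_subset by blast
      show ?q if ?p
      proof -
        have "nbh G x = {v1}" if "deg G x = 1"
          using that v1x by (metis card_1_singletonE deg_def singletonD)
        moreover have "nbh G v2 - {v1} \<subseteq> V1" using nbh_subset(2)[OF v(2)] by blast
        moreover have "{v1} \<subseteq> nbh G v2" using v(3) adj_commute[of v1 v2] by simp
        ultimately show ?thesis using \<open>?p\<close> by metis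
      qed
      show ?p if ?q
      proof -
        have "nbh G x = V1" if "nbh G v2 - {v1} \<subseteq> nbh G x"
        proof
          show "nbh G x \<subseteq> V1" using nbh_subset xV by blast
          show "V1 \<subseteq> nbh G x"
          proof
            fix z assume "z \<in> V1"
            then have "x \<in> nbh G z" if "z \<notin> nbh G v2" using that a x by blast
            then show "z \<in> nbh G x"
              using v1x that adj_commute[of x z] by (cases "z \<in> nbh G v2") auto
          qed
        qed
        then show ?thesis using \<open>?q\<close> by blast
      qed
    qed
    \<comment> \<open>The vertex \<open>v2\<close> can be left out, since it satisfies
      \<open>nbh G x \<subseteq> nbh G v2\<close> trivially.\<close>
    have "?d \<longleftrightarrow> (\<forall>x\<in>nbh G v1 - {v2}. 3 \<le> deg G v1 \<longrightarrow>
        deg G x = 1 \<or> nbh G x \<subseteq> nbh G v2 \<or> nbh G x = V1)" by blast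
    also have "\<dots> \<longleftrightarrow> ?c"
    proof (intro ball_cong refl)
      fix x assume x: "x \<in> nbh G v1 - {v2}"
      show "(3 \<le> deg G v1 \<longrightarrow> deg G x = 1 \<or> nbh G x \<subseteq> nbh G v2 \<or> nbh G x = V1) \<longleftrightarrow>
        (nbh G v1 - {v2} = {x} \<or> nbh G v2 - {v1} \<subseteq> nbh G x \<or> nbh G x \<subseteq> nbh G v2)"
        using *[OF x] deg_ge_3_iff[OF v(3) x] by argo
    qed
    finally show ?thesis .
  qed
  moreover have "?a \<longleftrightarrow> (\<forall>y\<in>V1 - nbh G v2. \<forall>x\<in>nbh G v1 - {v2}. y \<rightarrow>\<^bsub>G\<^esub> x)"
    unfolding subset_eq mem_nbh ..
  ultimately show ?thesis unfolding Im1_half_def by blast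
qed

lemma maximal_irredundant_adjacent_pair_iff:
  assumes v: "v1 \<in> V1" "v2 \<in> V2" "v1 \<rightarrow>\<^bsub>G\<^esub> v2"
  shows "maximal_irredundant G {v1, v2} \<longleftrightarrow>
    2 \<le> deg G v1 \<and> 2 \<le> deg G v2 \<and> Im1_half G V1 v1 v2 \<and> Im1_half G V2 v2 v1"
proof -
  interpret S: bipartite_graph G V2 V1 by (rule swap)
  have v': "v2 \<rightarrow>\<^bsub>G\<^esub> v1" using v adj_commute by blast
  \<comment> \<open>The candidates for extending the pair fall into four classes, namely
    non-neighbours and neighbours of \<open>v1\<close> or of \<open>v2\<close>, one for each
    insertion lemma and orientation.\<close>
  have split: "(\<forall>w\<in>verts G - {v1, v2}. P w) \<longleftrightarrow>
    (\<forall>w\<in>V2 - nbh G v1. P w) \<and> (\<forall>w\<in>nbh G v1 - {v2}. P w) \<and>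
    (\<forall>w\<in>V1 - nbh G v2. P w) \<and> (\<forall>w\<in>nbh G v2 - {v1}. P w)" for P
  proof -
    have "verts G - {v1, v2} = (V2 - nbh G v1) \<union> (nbh G v1 - {v2}) \<union> (V1 - nbh G v2) \<union> (nbh G v2 - {v1})"
      using v v' nbh_subset(1)[OF v(1)] nbh_subset(2)[OF v(2)] disjoint verts_eq by auto
    then show ?thesis by blast
  qed
  have ins: "{v1, v2} \<union> {w} = {v1, v2, w}" "{v1, v2, w} = {v2, v1, w}" for w by auto
  have "maximal_irredundant G {v1, v2} \<longleftrightarrow> irredundant G {v1, v2} \<and>
      (\<forall>w\<in>V2 - nbh G v1. \<not> irredundant G {v1, v2, w}) \<and>
      (\<forall>w\<in>nbh G v1 - {v2}. \<not> irredundant G {v1, v2, w}) \<and>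
      (\<forall>w\<in>V1 - nbh G v2. \<not> irredundant G {v2, v1, w}) \<and>
      (\<forall>w\<in>nbh G v2 - {v1}. \<not> irredundant G {v2, v1, w})"
    unfolding maximal_irredundant_def split ins(1) ins(2)[symmetric] by blast
  \<comment> \<open>The side condition holds as soon as the pair itself is irredundant, which both
    sides of the goal entail.\<close>
  moreover have "(\<forall>w\<in>V2 - nbh G v1. \<not> irredundant G {v1, v2, w}) \<longleftrightarrow>
      (\<forall>w\<in>V2 - nbh G v1. nbh G v2 - {v1} \<subseteq> nbh G w)" if "nbh G v1 - {v2} \<noteq> {}"
    using irredundant_adjacent_pair_insert_nonneighbor_iff[OF v] that by blast
  moreover have "(\<forall>w\<in>V1 - nbh G v2. \<not> irredundant G {v2, v1, w}) \<longleftrightarrow>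
      (\<forall>w\<in>V1 - nbh G v2. nbh G v1 - {v2} \<subseteq> nbh G w)" if "nbh G v2 - {v1} \<noteq> {}"
    using S.irredundant_adjacent_pair_insert_nonneighbor_iff[OF v(2,1) v'] that by blast
  moreover have "(\<forall>w\<in>nbh G v1 - {v2}. \<not> irredundant G {v1, v2, w}) \<longleftrightarrow>
      (\<forall>x\<in>nbh G v1 - {v2}.
        nbh G v1 - {v2} = {x} \<or> nbh G v2 - {v1} \<subseteq> nbh G x \<or> nbh G x \<subseteq> nbh G v2)"
    using irredundant_adjacent_pair_insert_neighbor_iff[OF v] by blast
  moreover have "(\<forall>w\<in>nbh G v2 - {v1}. \<not> irredundant G {v2, v1, w}) \<longleftrightarrow>
      (\<forall>x\<in>nbh G v2 - {v1}.
        nbh G v2 - {v1} = {x} \<or> nbh G v1 - {v2} \<subseteq> nbh G x \<or> nbh G x \<subseteq> nbh G v1)"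
    using S.irredundant_adjacent_pair_insert_neighbor_iff[OF v(2,1) v'] by blast
  ultimately show ?thesis
    unfolding irredundant_adjacent_pair_iff[OF v] Im1_half_iff[OF v]
      S.Im1_half_iff[OF v(2,1) v'] deg_ge_2_iff[OF v(3)] deg_ge_2_iff[OF v']
    by argo
qed

lemma maximal_irredundant_pair_iff:
  "(\<exists>v1\<in>V1. \<exists>v2\<in>V2. maximal_irredundant G {v1, v2}) \<longleftrightarrow>
    property_Im1 G V1 V2 \<or> property_Im2 G V1 V2"
proof -
  have "maximal_irredundant G {v1, v2} \<longleftrightarrow>
      v1 \<rightarrow>\<^bsub>G\<^esub> v2 \<and> 2 \<le> deg G v1 \<and> 2 \<le> deg G v2 \<and>
        Im1_half G V1 v1 v2 \<and> Im1_half G V2 v2 v1 \<or>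
      \<not> v1 \<rightarrow>\<^bsub>G\<^esub> v2 \<and> nbh G v1 = V2 - {v2} \<and> nbh G v2 = V1 - {v1}"
    if "v1 \<in> V1" "v2 \<in> V2" for v1 v2
    using maximal_irredundant_nonadjacent_pair_iff[OF that]
      maximal_irredundant_adjacent_pair_iff[OF that] by argo
  then show ?thesis
    unfolding property_Im1_iff property_Im2_def by (simp cong: bex_cong add: bex_disj_distrib)
qed


section \<open>From the properties to the families\<close>

lemma family_F2I:
  assumes "v1 \<in> V1" "v2 \<in> V2" "nbh G v1 = V2" "nbh G v2 = V1"
  shows "G \<in> family_F2"
  unfolding family_F2_def using assms bip graph_axioms by blast

lemma family_F3I:
  assumes "v1 \<in> V1" "v2 \<in> V2" "nbh G v1 = V2 - {v2}" "nbh G v2 = V1 - {v1}"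
  shows "G \<in> family_F3"
proof -
  have "\<not> v1 \<rightarrow>\<^bsub>G\<^esub> v2" using assms(3) by (metis DiffD2 insertI1 mem_nbh)
  then show ?thesis unfolding family_F3_def using assms bip graph_axioms by blast
qed

lemma family_F1I:
  assumes V1: "V1 = {v1, x}" "v1 \<noteq> x"
    and v2: "v2 \<in> nbh G v1" "v2 \<in> nbh G x"
    and ne: "nbh G v1 - {v2} \<noteq> {}" "V2 - nbh G v1 \<noteq> {}"
    and sub: "V2 - nbh G v1 \<subseteq> nbh G x"
  shows "G \<in> family_F1"
proof -
  \<comment> \<open>The leaves of \<open>v1\<close> form \<open>A\<close>, those of \<open>x\<close>
    form \<open>B\<close>, and \<open>S\<close> collects the members of \<open>A\<close> that are
    joined to \<open>x\<close> as well.\<close>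
  define A where "A = nbh G v1 - {v2}"
  define B where "B = V2 - nbh G v1"
  define S where "S = nbh G x \<inter> A"
  have nbhs: "nbh G v1 \<subseteq> V2" "nbh G x \<subseteq> V2" using nbh_subset V1 by auto
  have V2: "V2 = {v2} \<union> A \<union> B" unfolding A_def B_def using nbhs v2 by blast
  have n1: "nbh G v1 = insert v2 A" unfolding A_def using v2 by blast
  have nx: "nbh G x = {v2} \<union> B \<union> S"
    unfolding S_def using V2 nbhs v2 sub unfolding B_def by blast
  \<comment> \<open>Every edge meets \<open>V1 = {v1, x}\<close>, so the two neighbourhoods
    determine the graph.\<close>
  have "arcs_ends G = symcl ({v1} \<times> nbh G v1 \<union> {x} \<times> nbh G x)"
  proof -
    have "p = v1 \<or> p = x \<or> q = v1 \<or> q = x" if "p \<rightarrow>\<^bsub>G\<^esub> q" for p q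
      using that bip V1 by (auto simp: bipartition_def)
    then have "p \<rightarrow>\<^bsub>G\<^esub> q \<longleftrightarrow> (p, q) \<in> symcl ({v1} \<times> nbh G v1 \<union> {x} \<times> nbh G x)" for p q
      using adj_commute[of p q] by (auto simp: mem_symcl_iff)
    then show ?thesis by auto
  qed
  also have "\<dots> = linked_stars v1 A v2 x B \<union> symcl ({x} \<times> S)"
    unfolding linked_stars_def n1 nx by (auto simp: mem_symcl_iff)
  finally have arcs: "arcs_ends G = linked_stars v1 A v2 x B \<union> symcl ({x} \<times> S)" .
  have "distinct [v1, v2, x]" "(A \<union> B) \<inter> {v1, v2, x} = {}" "A \<inter> B = {}"
    using V1 v2 nbhs disjoint unfolding A_def B_def by (auto simp del: mem_nbh)
  moreover have "S \<subseteq> linked_stars v1 A v2 x B `` {v1}"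
    by (auto simp: S_def linked_stars_def mem_symcl_iff)
  moreover have "verts G = {v1, v2, x} \<union> A \<union> B" using verts_eq V1 V2 by blast
  moreover have "A \<noteq> {}" "B \<noteq> {}" using ne unfolding A_def B_def by blast+
  ultimately show ?thesis
    unfolding family_F1_def using arcs bip graph_axioms by blast
qed

text \<open>Any \<open>x\<close> in \<open>nbh G v2 - {v1}\<close> is adjacent to everything outside
  \<open>nbh G v1\<close>, so \<open>nbh G x \<subseteq> nbh G v1\<close> fails. Either
  \<open>x\<close> is the only other vertex of \<open>V1\<close>, which gives
  \<open>family_F1\<close>, or \<open>x\<close> is adjacent to all of \<open>V2\<close> and replaces
  \<open>v1\<close> as witness for \<open>family_F2\<close>.\<close>

lemma Im1_one_sided_imp_family:
  assumes v: "v1 \<in> V1" "v2 \<in> V2" "v1 \<rightarrow>\<^bsub>G\<^esub> v2"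
    and deg: "2 \<le> deg G v1" "2 \<le> deg G v2"
    and half: "Im1_half G V2 v2 v1"
    and dom: "nbh G v2 = V1" and notdom: "V2 - nbh G v1 \<noteq> {}"
  shows "G \<in> family_F1 \<union> family_F2"
proof -
  interpret S: bipartite_graph G V2 V1 by (rule swap)
  have v': "v2 \<rightarrow>\<^bsub>G\<^esub> v1" using v adj_commute by blast
  from half have a: "\<And>y. y \<in> V2 - nbh G v1 \<Longrightarrow> nbh G v2 - {v1} \<subseteq> nbh G y"
    and c: "\<And>x. x \<in> nbh G v2 - {v1} \<Longrightarrow>
      nbh G v2 - {v1} = {x} \<or> nbh G v1 - {v2} \<subseteq> nbh G x \<or> nbh G x \<subseteq> nbh G v1"
    unfolding S.Im1_half_iff[OF v(2,1) v'] by blast+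
  obtain x where x: "x \<in> nbh G v2 - {v1}" using deg deg_ge_2_iff[OF v'] by blast
  have xV: "x \<in> V1" using x dom by blast
  have sub: "V2 - nbh G v1 \<subseteq> nbh G x" using a x adj_commute[of x] by fastforce
  have v2x: "v2 \<in> nbh G x" using x adj_commute[of x] by simp
  from c[OF x] consider "nbh G v2 - {v1} = {x}" | "nbh G v1 - {v2} \<subseteq> nbh G x"
    using sub notdom by blast
  then show ?thesis
  proof cases
    case 1
    then have "V1 = {v1, x}" "v1 \<noteq> x" using dom v by blast+
    moreover have "nbh G v1 - {v2} \<noteq> {}" using deg deg_ge_2_iff[OF v(3)] by blast
    ultimately show ?thesis using family_F1I[of v1 x v2] v2x v(3) notdom sub by simp
  next
    case 2
    then have "nbh G x = V2" using sub v2x nbh_subset(1)[OF xV] by blast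
    then show ?thesis using family_F2I[OF xV v(2) _ dom] by blast
  qed
qed

lemma property_Im1_imp_family:
  assumes "property_Im1 G V1 V2"
  shows "G \<in> family_F1 \<union> family_F2 \<union> family_F3"
proof -
  interpret S: bipartite_graph G V2 V1 by (rule swap)
  obtain v1 v2 where v: "v1 \<in> V1" "v2 \<in> V2" "v1 \<rightarrow>\<^bsub>G\<^esub> v2"
    and deg: "2 \<le> deg G v1" "2 \<le> deg G v2"
    and half: "Im1_half G V1 v1 v2" "Im1_half G V2 v2 v1"
    using assms unfolding property_Im1_iff by blast
  have v': "v2 \<rightarrow>\<^bsub>G\<^esub> v1" using v adj_commute by blast
  have nbhs: "nbh G v1 \<subseteq> V2" "nbh G v2 \<subseteq> V1" using nbh_subset v by blast+
  consider "nbh G v1 = V2" "nbh G v2 = V1"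
    | "V2 - nbh G v1 \<noteq> {}" "nbh G v2 = V1"
    | "V1 - nbh G v2 \<noteq> {}" "nbh G v1 = V2"
    | "V2 - nbh G v1 \<noteq> {}" "V1 - nbh G v2 \<noteq> {}"
    using nbhs by blast
  then show ?thesis
  proof cases
    case 1
    then show ?thesis using family_F2I v by blast
  next
    case 2
    then show ?thesis using Im1_one_sided_imp_family[OF v deg half(2)] by blast
  next
    case 3
    then show ?thesis using S.Im1_one_sided_imp_family[OF v(2,1) v' deg(2,1) half(1)] by blast
  next
    case 4
    \<comment> \<open>The witnesses are no longer \<open>v1\<close> and \<open>v2\<close> but the
      pair \<open>b\<close>, \<open>a\<close> of their private neighbours; its adjacency decides
      between \<open>family_F2\<close> and \<open>family_F3\<close>.\<close>
    obtain a where a: "a \<in> nbh G v1 - {v2}" using deg deg_ge_2_iff[OF v(3)] by blast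
    obtain b where b: "b \<in> nbh G v2 - {v1}" using deg deg_ge_2_iff[OF v'] by blast
    have aV: "a \<in> V2" and bV: "b \<in> V1" using a b nbhs by blast+
    have Da: "V1 - nbh G v2 \<subseteq> nbh G y" if "y \<in> nbh G v1 - {v2}" for y
      using half(1) that adj_commute[of y] unfolding Im1_half_def by fastforce
    have Cb: "V2 - nbh G v1 \<subseteq> nbh G y" if "y \<in> nbh G v2 - {v1}" for y
      using half(2) that adj_commute[of y] unfolding Im1_half_def by fastforce
    \<comment> \<open>The alternative \<open>nbh G y \<subseteq> nbh G v2\<close> is excluded,
      because by \<open>Da\<close> the vertex \<open>y\<close> has a neighbour outside
      \<open>nbh G v2\<close>.\<close>
    have na: "nbh G v1 - {v2} = {y} \<or> nbh G v2 - {v1} \<subseteq> nbh G y"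
      if "y \<in> nbh G v1 - {v2}" for y
      using half(1) that Da[OF that] 4 unfolding Im1_half_iff[OF v] by blast
    have nb: "nbh G v2 - {v1} = {y} \<or> nbh G v1 - {v2} \<subseteq> nbh G y"
      if "y \<in> nbh G v2 - {v1}" for y
      using half(2) that Cb[OF that] 4 unfolding S.Im1_half_iff[OF v(2,1) v'] by blast
    have v1a: "v1 \<in> nbh G a" and v2b: "v2 \<in> nbh G b"
      using a b adj_commute[of a] adj_commute[of b] by auto
    have nbh_ab: "nbh G a \<subseteq> V1" "nbh G b \<subseteq> V2" using nbh_subset aV bV by blast+
    have ab: "a \<in> nbh G b \<longleftrightarrow> b \<in> nbh G a" using adj_commute[of a b] by simp
    show ?thesis
    proof (cases "b \<in> nbh G a")
      case True
      have "y \<in> nbh G a" if y: "y \<in> nbh G v2 - {v1}" for y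
        using nb[OF y] a b y True adj_commute[of y a] by (metis mem_nbh singletonD subsetD)
      moreover have "y \<in> nbh G b" if y: "y \<in> nbh G v1 - {v2}" for y
        using na[OF y] a b y True ab adj_commute[of y b] by (metis mem_nbh singletonD subsetD)
      ultimately have "nbh G v2 - {v1} \<subseteq> nbh G a" "nbh G v1 - {v2} \<subseteq> nbh G b" by blast+
      then have "nbh G a = V1" "nbh G b = V2"
        using Da[OF a] Cb[OF b] v1a v2b nbh_ab by blast+
      then show ?thesis using family_F2I[OF bV aV] by blast
    next
      case False
      \<comment> \<open>The other alternatives of \<open>na\<close> and \<open>nb\<close> would make
        \<open>a\<close> and \<open>b\<close> adjacent.\<close>
      then have "nbh G v1 - {v2} = {a}" "nbh G v2 - {v1} = {b}" using na[OF a] nb[OF b] a b ab by blast+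
      then have "nbh G a = V1 - {b}" "nbh G b = V2 - {a}"
        using Da[OF a] Cb[OF b] v1a v2b nbh_ab False ab by blast+
      then show ?thesis using family_F3I[OF bV aV] by blast
    qed
  qed
qed

text \<open>Conditions (a) and (b) are vacuous, and (c) holds because \<open>nbh G v2\<close> and
  \<open>nbh G v1\<close> are whole sides. The assumption \<open>nt\<close> yields the degree
  bounds.\<close>

lemma family_F2_imp_property_Im1:
  assumes v: "v1 \<in> V1" "v2 \<in> V2" "nbh G v1 = V2" "nbh G v2 = V1"
    and nt: "V1 \<noteq> {v1}" "V2 \<noteq> {v2}"
  shows "property_Im1 G V1 V2"
proof -
  interpret S: bipartite_graph G V2 V1 by (rule swap)
  have adj: "v1 \<rightarrow>\<^bsub>G\<^esub> v2" "v2 \<rightarrow>\<^bsub>G\<^esub> v1" using v by (metis mem_nbh)+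
  have "2 \<le> deg G v1" "2 \<le> deg G v2"
    unfolding deg_ge_2_iff[OF adj(1)] deg_ge_2_iff[OF adj(2)] using v nt by blast+
  moreover have "Im1_half G V1 v1 v2" "Im1_half G V2 v2 v1"
    unfolding Im1_half_iff[OF v(1,2) adj(1)] S.Im1_half_iff[OF v(2,1) adj(2)]
    using v(3,4) nbh_subset by blast+
  ultimately show ?thesis unfolding property_Im1_iff using v(1,2) adj(1) by blast
qed

lemma maximal_irredundant_singleton_imp_star:
  assumes "maximal_irredundant G {v}" "n = card (verts G)"
  shows "complete_bipartite_digraph 1 (n - 1) G"
proof -
  have v: "v \<in> verts G" "nbh G v = verts G - {v}"
    using assms(1) unfolding maximal_irredundant_singleton_iff by blast+
  have "n \<ge> 1" using v(1) assms(2) by (auto simp: Suc_le_eq card_gt_0_iff)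
  moreover have "V1 = {v} \<and> V2 = verts G - {v} \<or> V2 = {v} \<and> V1 = verts G - {v}"
  proof (cases "v \<in> V1")
    case True
    then show ?thesis using v nbh_subset(1)[OF True] verts_eq disjoint by blast
  next
    case False
    then have "v \<in> V2" using v(1) verts_eq by blast
    then show ?thesis using v nbh_subset(2)[of v] verts_eq disjoint by blast
  qed
  then have "bipartition G {v} (verts G - {v})" using bip bipartition_swap by metis
  ultimately show ?thesis using v assms(2) star_iff by blast
qed

end

section \<open>From the families to the properties, and the case of two colours\<close>

context graph
begin

text \<open>The witnesses are \<open>v1\<close> and \<open>v2\<close>, with
  \<open>V1 = {v1, x}\<close>. One half follows from \<open>nbh G v2 = V1\<close>, the other from
  \<open>x\<close> being the only neighbour of \<open>v2\<close> besides \<open>v1\<close>.\<close>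

lemma family_F1_imp_property_Im1:
  assumes "G \<in> family_F1"
  shows "\<exists>V1 V2. bipartition G V1 V2 \<and> property_Im1 G V1 V2"
proof -
  obtain v1 v2 x A B S where d: "distinct [v1, v2, x]" "A \<noteq> {}" "B \<noteq> {}" "A \<inter> B = {}"
    "(A \<union> B) \<inter> {v1, v2, x} = {}" and S: "S \<subseteq> linked_stars v1 A v2 x B `` {v1}"
    and verts: "verts G = {v1, v2, x} \<union> A \<union> B"
    and arcs: "arcs_ends G = linked_stars v1 A v2 x B \<union> symcl ({x} \<times> S)"
    using assms unfolding family_F1_def by blast
  define V1 where "V1 = {v1, x}"
  define V2 where "V2 = {v2} \<union> A \<union> B"
  have "S \<subseteq> insert v2 A" using S d by (auto simp: linked_stars_def mem_symcl_iff)
  then have bip: "bipartition G V1 V2"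
    unfolding bipartition_def verts arcs V1_def V2_def
    using d by (auto simp: linked_stars_def mem_symcl_iff)
  then interpret bipartite_graph G V1 V2 by unfold_locales
  interpret S: bipartite_graph G V2 V1 by (rule swap)
  have n1: "nbh G v1 = insert v2 A" and n2: "nbh G v2 = V1" and nx: "B \<subseteq> nbh G x"
    using d \<open>S \<subseteq> insert v2 A\<close> unfolding nbh_def arcs
    by (auto simp: linked_stars_def mem_symcl_iff V1_def)
  have v: "v1 \<in> V1" "v2 \<in> V2" by (auto simp: V1_def V2_def)
  have adj: "v1 \<rightarrow>\<^bsub>G\<^esub> v2" "v2 \<rightarrow>\<^bsub>G\<^esub> v1" using v n1 n2 by (metis mem_nbh insertI1)+
  have n2': "nbh G v2 - {v1} = {x}" using n2 d unfolding V1_def by auto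
  have "2 \<le> deg G v1" "2 \<le> deg G v2"
    unfolding deg_ge_2_iff[OF adj(1)] deg_ge_2_iff[OF adj(2)] n2' n1 using d by auto
  moreover have "Im1_half G V1 v1 v2"
    unfolding Im1_half_iff[OF v adj(1)] using n2 v nbh_subset by blast
  moreover have "x \<in> nbh G y" if "y \<in> V2 - nbh G v1" for y
    using that n1 nx adj_commute[of x y] by (auto simp: V2_def)
  then have "Im1_half G V2 v2 v1"
    unfolding S.Im1_half_iff[OF v(2,1) adj(2)] n2' by blast
  ultimately show ?thesis unfolding property_Im1_iff using v adj(1) bip by blast
qed

lemma property_Im_iff_family:
  assumes "\<not> complete_bipartite_digraph 1 (card (verts G) - 1) G"
  shows "(\<exists>V1 V2. bipartition G V1 V2 \<and> (property_Im1 G V1 V2 \<or> property_Im2 G V1 V2)) \<longleftrightarrow>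
    G \<in> family_F1 \<union> family_F2 \<union> family_F3" (is "?L \<longleftrightarrow> ?R")
proof
  assume ?L
  then obtain V1 V2 where bip: "bipartition G V1 V2"
    and P: "property_Im1 G V1 V2 \<or> property_Im2 G V1 V2" by blast
  from bip interpret bipartite_graph G V1 V2 by unfold_locales
  have "property_Im2 G V1 V2 \<Longrightarrow> G \<in> family_F3"
    unfolding property_Im2_def using family_F3I by blast
  then show ?R using P property_Im1_imp_family by blast
next
  assume ?R
  moreover have ?L if "G \<in> family_F1" using family_F1_imp_property_Im1[OF that] by blast
  moreover have ?L if "G \<in> family_F3"
    using that unfolding family_F3_def property_Im2_def by blast
  moreover have ?L if F2: "G \<in> family_F2"
  proof -
    obtain V1 V2 v1 v2 where bip: "bipartition G V1 V2"
      and v: "v1 \<in> V1" "v2 \<in> V2" "nbh G v1 = V2" "nbh G v2 = V1"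
      using F2 unfolding family_F2_def by blast
    from bip interpret bipartite_graph G V1 V2 by unfold_locales
    \<comment> \<open>In a non-star no vertex dominates. This keeps both sides of a graph in
      \<open>family_F2\<close> from being singletons.\<close>
    have nbh_ne: "nbh G u \<noteq> verts G - {u}" if "u \<in> verts G" for u
      using that maximal_irredundant_singleton_imp_star[OF _ refl] assms
        maximal_irredundant_singleton_iff by blast
    have "verts G - V1 = V2" "verts G - V2 = V1" "v1 \<in> verts G" "v2 \<in> verts G"
      using verts_eq disjoint v(1,2) by blast+
    then have "V1 \<noteq> {v1}" "V2 \<noteq> {v2}" using nbh_ne v(3,4) by metis+
    then show ?thesis using family_F2_imp_property_Im1[OF v] bip by blast
  qed
  ultimately show ?L by blast
qed

text \<open>A maximal irredundant set is nonempty, and in a bipartite non-star it is not a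
  singleton. Meeting each side at most once, it therefore meets each side exactly once.\<close>

lemma irredundance_chromatic_number_eq_2_iff_property_Im:
  assumes edge: "u \<rightarrow>\<^bsub>G\<^esub> v" and "\<not> complete_bipartite_digraph 1 (card (verts G) - 1) G"
  shows "\<chi>\<^sub>i G = 2 \<longleftrightarrow>
    (\<exists>V1 V2. bipartition G V1 V2 \<and> (property_Im1 G V1 V2 \<or> property_Im2 G V1 V2))"
proof -
  have "(\<exists>R. maximal_irredundant G R \<and> card (R \<inter> V1) \<le> 1 \<and> card (R \<inter> V2) \<le> 1) \<longleftrightarrow>
    property_Im1 G V1 V2 \<or> property_Im2 G V1 V2" (is "?L \<longleftrightarrow> ?R")
    if bip: "bipartition G V1 V2" for V1 V2
  proof -
    from bip interpret bipartite_graph G V1 V2 by unfold_locales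
    show ?thesis
      unfolding maximal_irredundant_pair_iff[symmetric]
    proof
      assume ?L
      then obtain R where R: "maximal_irredundant G R"
        and le: "card (R \<inter> V1) \<le> 1" "card (R \<inter> V2) \<le> 1" by blast
      have RV: "R \<subseteq> V1 \<union> V2"
        using R verts_eq by (auto simp: maximal_irredundant_def irredundant_def)
      have "finite R"
        using RV verts_eq finite_verts by (metis finite_subset)
      have "R \<noteq> {}"
        using maximal_irredundant_nonempty[OF R] edge by (auto dest: adj_in_verts)
      have one: "\<exists>x. R \<inter> W = {x}" if "R \<inter> W \<noteq> {}" "card (R \<inter> W) \<le> 1" for W
        using that \<open>finite R\<close>
        by (metis One_nat_def card_1_singletonE card_gt_0_iff finite_Int le_antisym Suc_leI)
      have no_single: "R \<noteq> {x}" for x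
        using R maximal_irredundant_singleton_imp_star assms(2) by blast
      have "R \<inter> V1 \<noteq> {}"
        using one[of V2] le no_single RV \<open>R \<noteq> {}\<close> by (metis Int_Un_distrib Un_empty_left inf.absorb1)
      moreover have "R \<inter> V2 \<noteq> {}"
        using one[of V1] le no_single RV \<open>R \<noteq> {}\<close> by (metis Int_Un_distrib Un_empty_right inf.absorb1)
      ultimately obtain v1 v2 where "R \<inter> V1 = {v1}" "R \<inter> V2 = {v2}"
        using one le by metis
      then have "R = {v1, v2}" "v1 \<in> V1" "v2 \<in> V2" using RV by blast+
      then show "\<exists>v1\<in>V1. \<exists>v2\<in>V2. maximal_irredundant G {v1, v2}" using R by blast
    next
      assume "\<exists>v1\<in>V1. \<exists>v2\<in>V2. maximal_irredundant G {v1, v2}"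
      then obtain v1 v2 where v: "v1 \<in> V1" "v2 \<in> V2" "maximal_irredundant G {v1, v2}" by blast
      then have "{v1, v2} \<inter> V1 = {v1}" "{v1, v2} \<inter> V2 = {v2}" using disjoint by auto
      then show ?L using v(3) by (intro exI[of _ "{v1, v2}"]) simp
    qed
  qed
  then show ?thesis unfolding irredundance_chromatic_number_eq_2_iff[OF edge] by blast
qed

lemma irredundance_chromatic_number_star:
  assumes edge: "u \<rightarrow>\<^bsub>G\<^esub> v" and "complete_bipartite_digraph 1 (card (verts G) - 1) G"
  shows "\<chi>\<^sub>i G = 2"
proof -
  have "card (verts G) \<ge> 1"
    using adj_in_verts[OF edge] by (auto simp: Suc_le_eq card_gt_0_iff)
  then obtain w where w: "w \<in> verts G" "bipartition G {w} (verts G - {w})"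
    "nbh G w = verts G - {w}"
    using assms(2) star_iff[OF refl] by blast
  then have "maximal_irredundant G {w}" by (simp add: maximal_irredundant_singleton_iff)
  moreover have "card ({w} \<inter> {w}) \<le> 1" "card ({w} \<inter> (verts G - {w})) \<le> 1" by simp_all
  ultimately show ?thesis
    unfolding irredundance_chromatic_number_eq_2_iff[OF edge] using w(2) by blast
qed

end

theorem theorem3:
  fixes G :: "('a, 'b) pre_digraph" and n :: nat
  assumes "graph G" and "Digraph_Component.connected G"
    and "card (verts G) = n" and "n \<ge> 2"
    and "\<forall>v\<in>verts G. nbh G v \<noteq> {}"
  shows "(2 \<le> \<chi>\<^sub>i G \<and> \<chi>\<^sub>i G \<le> n) \<and>
    (\<chi>\<^sub>i G = n \<longleftrightarrow> complete_digraph n G) \<and>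
    (complete_bipartite_digraph 1 (n - 1) G \<longrightarrow> \<chi>\<^sub>i G = 2) \<and>
    (\<not> complete_bipartite_digraph 1 (n - 1) G \<longrightarrow>
      (\<chi>\<^sub>i G = 2 \<longleftrightarrow>
        (\<exists>V1 V2. bipartition G V1 V2 \<and> (property_Im1 G V1 V2 \<or> property_Im2 G V1 V2))) \<and>
      ((\<exists>V1 V2. bipartition G V1 V2 \<and> (property_Im1 G V1 V2 \<or> property_Im2 G V1 V2)) \<longleftrightarrow>
        G \<in> family_F1 \<union> family_F2 \<union> family_F3))"
proof -
  interpret graph G by fact
  have "verts G \<noteq> {}" using assms(3,4) by auto
  then obtain u v where edge: "u \<rightarrow>\<^bsub>G\<^esub> v" using assms(5) by fastforce
  show ?thesis
    using irredundance_chromatic_number_ge_2[OF edge] irredundance_chromatic_number_le_order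
      irredundance_chromatic_number_eq_order_iff[OF \<open>verts G \<noteq> {}\<close> assms(5)]
      irredundance_chromatic_number_star[OF edge]
      irredundance_chromatic_number_eq_2_iff_property_Im[OF edge] property_Im_iff_family
    unfolding assms(3) by blast
qed

end
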